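(* The triple $(\mathfrak S_1(\mathbb R),\mathfrak S_1(\mathbb T),p)$ has the path lifting property: if $\tilde S_0\in\mathfrak S_1(\mathbb R)$, $S\colon[0,1]\to\mathfrak S_1(\mathbb T)$ is continuous and $p(\tilde S_0)=S(0)$, then there exists a continuous path $\tilde S\colon[0,1]\to\mathfrak S_1(\mathbb R)$ with $\tilde S(0)=\tilde S_0$ and $S=p\circ\tilde S$.
   Context: A rigged subset $S$ of a set $X$ assigns to each $x\in X$ a multiplicity $\mathrm{mult}(x;S)\in\{0,1,2,\dots,\infty\}$; an enumeration is a sequence in which each $x$ appears $\mathrm{mult}(x;S)$ times. For a metric space $X$ with base point $x_0$, $\mathfrak S_\infty(X)$ consists of countable rigged subsets in which $x_0$ has multiplicity $\infty$ and with no accumulation point (a point every neighbourhood of which contains infinitely many elements counting multiplicity) other than $x_0$; $d(S,T)=\inf\sum_j\mathrm{dist}(s_j,t_j)$ over enumerations $(s_j),(t_j)$ of $S,T$; $\mathfrak S_1(X)=\{S:d(S,\mathbf x_0)<\infty\}$ where $\mathbf x_0$ is $x_0$ with infinite multiplicity. $\mathfrak S_1(\mathbb R)$ uses base point $0$, $\mathfrak S_1(\mathbb T)$ uses base point $1$ ($\mathbb T$ with arc-length metric). $p\colon\mathfrak S_1(\mathbb R)\to\mathfrak S_1(\mathbb T)$ is the map induced by $\theta\mapsto e^{i\theta}$ (multiplicities of points with the same image are added). *)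

theory Defs
  imports "HOL-Analysis.Analysis"
begin

text \<open>A rigged subset of a type 'a is a multiplicity function 'a \<Rightarrow> enat
  (the value \<infinity> meaning infinite multiplicity).  Spaces are given by an explicit
  carrier X, an explicit metric dst and a base point x0.\<close>

type_synonym 'a rigged = "'a \<Rightarrow> enat"

definition ecard :: "'a set \<Rightarrow> enat" where
  "ecard A = (if finite A then enat (card A) else \<infinity>)"

definition esum :: "'a rigged \<Rightarrow> 'a set \<Rightarrow> enat" where
  "esum S A = (if finite {x\<in>A. S x \<noteq> 0} then sum S {x\<in>A. S x \<noteq> 0} else \<infinity>)"

definition enumeration :: "'a rigged \<Rightarrow> (nat \<Rightarrow> 'a) \<Rightarrow> bool" where
  "enumeration S e \<longleftrightarrow> (\<forall>x. ecard {j. e j = x} = S x)"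

definition rdist :: "('a \<Rightarrow> 'a \<Rightarrow> real) \<Rightarrow> 'a rigged \<Rightarrow> 'a rigged \<Rightarrow> ennreal" where
  "rdist dst S T = (INF (s,t)\<in>{(s,t). enumeration S s \<and> enumeration T t}.
                      (\<Sum>j. ennreal (dst (s j) (t j))))"

definition accum_point :: "'a set \<Rightarrow> ('a \<Rightarrow> 'a \<Rightarrow> real) \<Rightarrow> 'a rigged \<Rightarrow> 'a \<Rightarrow> bool" where
  "accum_point X dst S x \<longleftrightarrow> (\<forall>e>0. esum S {y\<in>X. dst x y < e} = \<infinity>)"

definition base_rigged :: "'a \<Rightarrow> 'a rigged" where
  "base_rigged x0 = (\<lambda>x. if x = x0 then \<infinity> else 0)"

definition S_inf :: "'a set \<Rightarrow> ('a \<Rightarrow> 'a \<Rightarrow> real) \<Rightarrow> 'a \<Rightarrow> 'a rigged set" where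
  "S_inf X dst x0 = {S. (\<forall>x. x \<notin> X \<longrightarrow> S x = 0) \<and> countable {x. S x \<noteq> 0}
      \<and> S x0 = \<infinity> \<and> (\<forall>x\<in>X. accum_point X dst S x \<longrightarrow> x = x0)}"

definition S_one :: "'a set \<Rightarrow> ('a \<Rightarrow> 'a \<Rightarrow> real) \<Rightarrow> 'a \<Rightarrow> 'a rigged set" where
  "S_one X dst x0 = {S \<in> S_inf X dst x0. rdist dst S (base_rigged x0) < \<infinity>}"

definition S1R :: "real rigged set" where
  "S1R = S_one UNIV dist 0"

definition dR :: "real rigged \<Rightarrow> real rigged \<Rightarrow> ennreal" where
  "dR = rdist dist"

definition arcdist :: "complex \<Rightarrow> complex \<Rightarrow> real" where
  "arcdist z w = \<bar>Arg (z / w)\<bar>"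

definition S1T :: "complex rigged set" where
  "S1T = S_one (sphere 0 1) arcdist 1"

definition dT :: "complex rigged \<Rightarrow> complex rigged \<Rightarrow> ennreal" where
  "dT = rdist arcdist"

definition pmap :: "real rigged \<Rightarrow> complex rigged" where
  "pmap S = (\<lambda>z. esum S {\<theta>. cis \<theta> = z})"

definition path_cont :: "('b \<Rightarrow> 'b \<Rightarrow> ennreal) \<Rightarrow> (real \<Rightarrow> 'b) \<Rightarrow> bool" where
  "path_cont d P \<longleftrightarrow> (\<forall>t\<in>{0..1}. \<forall>\<epsilon>>0. \<exists>\<delta>>0. \<forall>s\<in>{0..1}.
      \<bar>s - t\<bar> < \<delta> \<longrightarrow> d (P s) (P t) < ennreal \<epsilon>)"

end

theory Submission
  imports Defs
begin

text \<open>
  Cut the circle open at the base point, so that its points become angles in \<open>(0, 2\<pi>)\<close>. Counting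
  the points of a rigged set between two angles gives a nondecreasing integer-valued level
  function on \<open>(0, 2\<pi>)\<close>, determined up to an additive integer, and a matching of two rigged sets
  of total cost below \<open>\<epsilon>\<close> makes their level functions \<open>\<epsilon>\<close>-close in \<open>L\<^sup>1\<close> after a suitable integer
  shift: the shorter arc between two matched points is where that pair contributes to the
  difference. Distinct shifts are at least \<open>2\<pi>\<close> apart, so a continuous path of rigged sets lifts to an
  \<open>L\<^sup>1\<close>-continuous path of level functions. The quantiles of the lifted level functions
  are continuous strands in \<open>[0, 2\<pi>]\<close> that enumerate the rigged sets away from the base
  point, and by the layer-cake formula the summed displacement of the strands is at most the
  \<open>L\<^sup>1\<close> distance of the level functions. Finally, an
  enumeration of the given initial lift is matched with the initial positions of the strands,
  and every point of the lift is moved along with its strand. Points over the base point that are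
  matched with no strand stay fixed; by summability almost all of them are zero, so the base point
  keeps infinite multiplicity.
\<close>

section \<open>Extended cardinalities, enumerations and matchings of fibres\<close>

lemma sum_enat_card: "finite F \<Longrightarrow> (\<Sum>x\<in>F. enat (f x)) = enat (\<Sum>x\<in>F. f x)"
  by (induction F rule: finite_induct) (auto simp: zero_enat_def)

lemma ecard_eq_infinity_iff [simp]: "ecard A = \<infinity> \<longleftrightarrow> infinite A"
  by (simp add: ecard_def)

lemma ecard_eq_0_iff [simp]: "ecard A = 0 \<longleftrightarrow> A = {}"
  by (auto simp: ecard_def zero_enat_def)

lemma ecard_image: "inj_on f A \<Longrightarrow> ecard (f ` A) = ecard A"
  by (auto simp: ecard_def card_image finite_image_iff)

lemma ecard_bij_betw: "bij_betw f A B \<Longrightarrow> ecard A = ecard B"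
  by (metis bij_betw_def ecard_image)

text \<open>The fibres of \<open>e\<close> over the support partition the indices. If infinitely
  many indices land in \<open>A\<close>, then either the support in \<open>A\<close> is infinite, or
  by the pigeonhole principle one of its points has multiplicity \<open>\<infinity>\<close>.\<close>

lemma esum_enumeration:
  assumes "enumeration S e"
  shows "esum S A = ecard {j. e j \<in> A}"
proof -
  let ?F = "{x \<in> A. S x \<noteq> 0}"
  have S: "S x = ecard {j. e j = x}" for x
    using assms by (simp add: enumeration_def)
  have F: "?F = e ` {j. e j \<in> A}"
    by (auto simp: S)
  have U: "{j. e j \<in> A} = (\<Union>x\<in>?F. {j. e j = x})"
    by (auto simp: S)
  show ?thesis
  proof (cases "finite {j. e j \<in> A}")
    case True
    then have fF: "finite ?F" and fin: "\<And>x. x \<in> ?F \<Longrightarrow> finite {j. e j = x}"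
      unfolding F by (auto intro: rev_finite_subset[OF True])
    have "card {j. e j \<in> A} = (\<Sum>x\<in>?F. card {j. e j = x})"
      by (subst U, rule card_UN_disjoint[OF fF]) (use fin in auto)
    moreover have "sum S ?F = (\<Sum>x\<in>?F. enat (card {j. e j = x}))"
    proof (rule sum.cong[OF refl])
      fix x assume "x \<in> ?F"
      then have "finite {j. e j = x}" by (rule fin)
      then show "S x = enat (card {j. e j = x})" by (simp add: S[of x] ecard_def)
    qed
    ultimately show ?thesis
      using True fF by (simp add: esum_def sum_enat_card ecard_def)
  next
    case inf: False
    show ?thesis
    proof (cases "finite ?F")
      case True
      then have "\<exists>x\<in>?F. infinite {j. e j = x}"
        using inf finite_UN_I[of ?F "\<lambda>x. {j. e j = x}"] unfolding U[symmetric] by blast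
      then obtain x where x: "x \<in> ?F" "infinite {j. e j = x}"
        by blast
      then have "S x = \<infinity>" by (simp add: S)
      moreover have "S x \<le> sum S ?F"
        using True x(1) by (intro member_le_sum) auto
      ultimately show ?thesis
        using inf True by (auto simp: esum_def ecard_def)
    next
      case False
      with inf show ?thesis by (simp add: esum_def ecard_def)
    qed
  qed
qed

text \<open>Countability makes \<open>\<infinity>\<close> stand for a single cardinality.\<close>

lemma bij_betw_eq_ecard:
  fixes A :: "'a::countable set" and B :: "'b::countable set"
  assumes "ecard A = ecard B"
  shows "\<exists>h. bij_betw h A B"
proof (cases "finite A")
  case True
  then have "finite B" "card A = card B"
    using assms by (auto simp: ecard_def split: if_splits)
  with True show ?thesis by (intro finite_same_card_bij)
next
  case False
  then have inf: "infinite B" using assms by (auto simp: ecard_def split: if_splits)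
  have "bij_betw (from_nat_into B) UNIV B"
    using inf by (intro bij_betw_from_nat_into) auto
  moreover have "bij_betw (to_nat_on A) A UNIV"
    using False by (intro to_nat_on_infinite) auto
  ultimately show ?thesis by (blast intro: bij_betw_trans)
qed

text \<open>Bijections between corresponding fibres glue to one bijection. This later matches the
  initial lift with the initial positions of the strands.\<close>

lemma bij_eq_fibre_ecard:
  fixes f :: "'a::countable \<Rightarrow> 'c" and g :: "'b::countable \<Rightarrow> 'c"
  assumes "\<And>x. ecard {a. f a = x} = ecard {b. g b = x}"
  obtains h where "bij h" "\<And>a. g (h a) = f a"
proof -
  have "\<forall>x. \<exists>h. bij_betw h {a. f a = x} {b. g b = x}"
    using bij_betw_eq_ecard[OF assms] by blast
  then obtain H where H: "\<And>x. bij_betw (H x) {a. f a = x} {b. g b = x}"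
    by metis
  define h where "h a = H (f a) a" for a
  have gh: "g (h a) = f a" for a
    using bij_betwE[OF H[of "f a"]] by (auto simp: h_def)
  have "inj h"
  proof (rule injI)
    fix a b assume eq: "h a = h b"
    then have "f a = f b" by (metis gh)
    with eq show "a = b"
      using bij_betw_imp_inj_on[OF H[of "f a"]] by (auto simp: h_def inj_on_def)
  qed
  moreover have "surj h"
    unfolding surj_def
  proof
    fix b
    have "b \<in> H (g b) ` {a. f a = g b}"
      using bij_betw_imp_surj_on[OF H[of "g b"]] by auto
    then show "\<exists>a. b = h a" by (auto simp: h_def) metis
  qed
  ultimately show ?thesis using that gh by (auto simp: bij_def)
qed

section \<open>Summable enumerations and the space \<open>S_one\<close>\<close>

lemma finite_large_terms:
  fixes f :: "nat \<Rightarrow> real"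
  assumes "(\<Sum>j. ennreal (f j)) < \<infinity>" "\<And>j. 0 \<le> f j" "0 < \<eta>"
  shows "finite {j. \<eta> \<le> f j}"
proof -
  have "f \<longlonglongrightarrow> 0"
    using assms by (intro summable_LIMSEQ_zero summable_suminf_not_top) auto
  then have "eventually (\<lambda>j. f j < \<eta>) sequentially"
    using assms(3) by (rule order_tendstoD)
  then obtain N where "\<And>j. j \<ge> N \<Longrightarrow> f j < \<eta>"
    by (auto simp: eventually_sequentially)
  then have "{j. \<eta> \<le> f j} \<subseteq> {..<N}" by (force simp: not_le[symmetric])
  then show ?thesis by (rule finite_subset) simp
qed

text \<open>A finite infimum provides a pair of enumerations with finite sum, and an enumeration of
  \<open>base_rigged x0\<close> can only be the constant sequence \<open>x0\<close>.\<close>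

lemma S_one_enumeration:
  assumes "S \<in> S_one X d x0"
  obtains e where "enumeration S e" "(\<Sum>j. ennreal (d (e j) x0)) < \<infinity>"
proof -
  have "rdist d S (base_rigged x0) < \<infinity>"
    using assms by (simp add: S_one_def)
  then obtain e t where e: "enumeration S e" "enumeration (base_rigged x0) t"
      "(\<Sum>j. ennreal (d (e j) (t j))) < \<infinity>"
    by (auto simp: rdist_def INF_less_iff)
  have "t j = x0" for j
  proof (rule ccontr)
    assume "t j \<noteq> x0"
    then have "ecard {i. t i = t j} = 0"
      using e(2) by (simp add: enumeration_def base_rigged_def)
    then show False by auto
  qed
  with e that show ?thesis by simp
qed

text \<open>An accumulation point \<open>x\<close> other than \<open>x0\<close> would force
  infinitely many terms to lie at least half of \<open>dist x x0\<close> away from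
  \<open>x0\<close>, which contradicts summability.\<close>

lemma S_one_dist_I:
  fixes e :: "nat \<Rightarrow> 'a::metric_space"
  assumes e: "enumeration S e" and x0: "S x0 = \<infinity>"
    and sum: "(\<Sum>j. ennreal (dist (e j) x0)) < \<infinity>"
  shows "S \<in> S_one UNIV dist x0"
proof -
  have S: "S x = ecard {j. e j = x}" for x
    using e by (simp add: enumeration_def)
  have "countable {x. S x \<noteq> 0}"
    by (rule countable_subset[of _ "range e"]) (auto simp: S)
  moreover have "x = x0" if acc: "accum_point UNIV dist S x" for x
  proof (rule ccontr)
    assume "x \<noteq> x0"
    define \<eta> where "\<eta> = dist x x0 / 2"
    have \<eta>: "\<eta> > 0" using \<open>x \<noteq> x0\<close> by (simp add: \<eta>_def)
    then have "infinite {j. e j \<in> {y \<in> UNIV. dist x y < \<eta>}}"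
      using acc esum_enumeration[OF e] unfolding accum_point_def by (metis ecard_eq_infinity_iff)
    moreover have "{j. e j \<in> {y \<in> UNIV. dist x y < \<eta>}} \<subseteq> {j. \<eta> \<le> dist (e j) x0}"
    proof safe
      fix j assume "dist x (e j) < \<eta>"
      moreover have "dist x x0 \<le> dist x (e j) + dist (e j) x0" by (rule dist_triangle)
      moreover have "dist x x0 = 2 * \<eta>" by (simp add: \<eta>_def)
      ultimately show "\<eta> \<le> dist (e j) x0" by linarith
    qed
    moreover have "finite {j. \<eta> \<le> dist (e j) x0}"
      using sum \<eta> by (intro finite_large_terms) auto
    ultimately show False using finite_subset by blast
  qed
  moreover have "rdist dist S (base_rigged x0) \<le> (\<Sum>j. ennreal (dist (e j) x0))"
  proof -
    have "enumeration (base_rigged x0) (\<lambda>_. x0)"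
      by (auto simp: enumeration_def base_rigged_def ecard_def zero_enat_def)
    with e show ?thesis
      unfolding rdist_def by (intro INF_lower2[of "(e, \<lambda>_. x0)"]) auto
  qed
  then have "rdist dist S (base_rigged x0) < \<infinity>" using sum by (rule le_less_trans)
  ultimately show ?thesis
    using x0 by (auto simp: S_one_def S_inf_def)
qed

section \<open>Angles and arc length on the circle\<close>

lemma arcdist_cis:
  assumes "\<bar>a - b\<bar> < 2 * pi"
  shows "arcdist (cis a) (cis b) = (if \<bar>a - b\<bar> \<le> pi then \<bar>a - b\<bar> else 2 * pi - \<bar>a - b\<bar>)"
proof -
  let ?d = "a - b"
  have A: "arcdist (cis a) (cis b) = \<bar>Arg (cis ?d)\<bar>"
    by (simp add: arcdist_def cis_divide)
  \<comment> \<open>\<open>Arg\<close> takes values in \<open>(-pi, pi]\<close>: the difference is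
    such a value, or is brought there by a full turn. At \<open>-pi\<close> the value of
    \<open>Arg\<close> is \<open>pi\<close>, with the same absolute value.\<close>
  consider "-pi < ?d" "?d \<le> pi" | "?d = -pi" | "?d > pi" | "?d < -pi" by linarith
  then show ?thesis
  proof cases
    case 1
    then have "\<bar>?d\<bar> \<le> pi" by linarith
    with 1 show ?thesis using A by (simp add: Arg_cis)
  next
    case 2
    have "cis ?d = cis pi" by (subst 2) (simp add: complex_eq_iff)
    then have "Arg (cis ?d) = Arg (cis pi)" by (rule arg_cong)
    also have "\<dots> = pi" by (rule Arg_cis) simp
    finally show ?thesis using A 2 by simp
  next
    case 3
    have "cis ?d = cis (?d - 2 * pi)" by (simp add: complex_eq_iff cos_diff sin_diff cos_add sin_add)
    moreover have "Arg (cis (?d - 2 * pi)) = ?d - 2 * pi"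
      using 3 assms by (intro Arg_cis) auto
    ultimately show ?thesis using A 3 assms by simp
  next
    case 4
    have "cis ?d = cis (?d + 2 * pi)" by (simp add: complex_eq_iff cos_diff sin_diff cos_add sin_add)
    moreover have "Arg (cis (?d + 2 * pi)) = ?d + 2 * pi"
      using 4 assms by (intro Arg_cis) auto
    ultimately show ?thesis using A 4 assms by simp
  qed
qed

lemma cis_eq_imp_eq:
  assumes "cis a = cis b" "\<bar>a - b\<bar> < 2 * pi"
  shows "a = b"
proof -
  have "arcdist (cis a) (cis b) = 0" by (simp add: assms(1) arcdist_def)
  with assms(2) show ?thesis by (auto simp: arcdist_cis split: if_splits)
qed

lemma cis_Arg2pi:
  assumes "norm z = 1"
  shows "cis (Arg2pi z) = z"
  using Arg2pi_eq[of z] assms by (simp add: cis_conv_exp)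

section \<open>Point counts on arcs and level functions\<close>

text \<open>Half-open arcs make counts on adjacent arcs add up. The value is meaningful for
  \<open>0 < u\<close> and \<open>v < 2 * pi\<close>, where the arc avoids the base point and the
  count is finite for members of \<open>S1T\<close>.\<close>

definition arc_count :: "complex rigged \<Rightarrow> real \<Rightarrow> real \<Rightarrow> nat" where
  "arc_count S u v = the_enat (esum S (cis ` {u<..v}))"

lemma mem_arc_iff:
  assumes "norm z = 1" "0 \<le> u" "v < 2 * pi"
  shows "z \<in> cis ` {u<..v} \<longleftrightarrow> Arg2pi z \<in> {u<..v}"
proof
  assume "z \<in> cis ` {u<..v}"
  then obtain \<theta> where \<theta>: "u < \<theta>" "\<theta> \<le> v" "z = cis \<theta>" by auto
  have "cis (Arg2pi z) = cis \<theta>" using assms(1) \<theta> by (simp add: cis_Arg2pi)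
  moreover have "\<bar>Arg2pi z - \<theta>\<bar> < 2 * pi"
    using Arg2pi[of z] \<theta> assms by linarith
  ultimately have "Arg2pi z = \<theta>" by (rule cis_eq_imp_eq)
  with \<theta> show "Arg2pi z \<in> {u<..v}" by simp
next
  assume "Arg2pi z \<in> {u<..v}"
  with assms show "z \<in> cis ` {u<..v}" by (metis cis_Arg2pi image_eqI)
qed

lemma S1T_enumeration_norm:
  assumes "S \<in> S1T" "enumeration S s"
  shows "norm (s j) = 1"
proof -
  have "S (s j) = ecard {i. s i = s j}"
    using assms(2) by (simp add: enumeration_def)
  then have "S (s j) \<noteq> 0" by auto
  then have "s j \<in> sphere 0 1"
    using assms(1) by (auto simp: S1T_def S_one_def S_inf_def)
  then show ?thesis by simp
qed

lemma S1T_esum_arc: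
  assumes S: "S \<in> S1T" and s: "enumeration S s" and uv: "0 < u" "v < 2 * pi"
  shows "esum S (cis ` {u<..v}) = ecard {j. Arg2pi (s j) \<in> {u<..v}}"
  unfolding esum_enumeration[OF s]
  by (intro arg_cong[of _ _ ecard] Collect_cong mem_arc_iff S1T_enumeration_norm[OF S s])
    (use uv in auto)

text \<open>Points on the arc keep a positive distance \<open>\<eta>\<close> from the base point, so
  only finitely many terms of a summable enumeration can lie there.\<close>

lemma S1T_finite_arc:
  assumes S: "S \<in> S1T" and s: "enumeration S s" and uv: "0 < u" "v < 2 * pi"
  shows "finite {j. Arg2pi (s j) \<in> {u<..v}}"
proof -
  obtain e where e: "enumeration S e" "(\<Sum>j. ennreal (arcdist (e j) 1)) < \<infinity>"
    by (rule S_one_enumeration[OF S[unfolded S1T_def]])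
  define \<eta> where "\<eta> = min u (2 * pi - v)"
  have "{j. Arg2pi (e j) \<in> {u<..v}} \<subseteq> {j. \<eta> \<le> arcdist (e j) 1}"
  proof safe
    fix j assume j: "Arg2pi (e j) \<in> {u<..v}"
    let ?a = "Arg2pi (e j)"
    have "arcdist (e j) 1 = arcdist (cis ?a) (cis 0)"
      by (simp add: cis_Arg2pi[OF S1T_enumeration_norm[OF S e(1)]])
    also have "\<dots> = (if ?a \<le> pi then ?a else 2 * pi - ?a)"
      using j uv by (subst arcdist_cis) auto
    finally show "\<eta> \<le> arcdist (e j) 1"
      using j by (auto simp: \<eta>_def)
  qed
  moreover have "finite {j. \<eta> \<le> arcdist (e j) 1}"
    by (rule finite_large_terms[OF e(2)]) (use uv in \<open>auto simp: \<eta>_def arcdist_def\<close>)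
  ultimately have "finite {j. Arg2pi (e j) \<in> {u<..v}}" by (rule finite_subset)
  \<comment> \<open>Only \<open>e\<close> is known to be summable, but \<open>esum\<close> depends
    on \<open>S\<close> alone, so finiteness passes from \<open>e\<close> to the given enumeration
    \<open>s\<close>.\<close>
  then have "esum S (cis ` {u<..v}) \<noteq> \<infinity>"
    using S1T_esum_arc[OF S e(1) uv] by simp
  then show ?thesis
    using S1T_esum_arc[OF S s uv] by simp
qed

lemma arc_count_card:
  assumes "S \<in> S1T" "enumeration S s" "0 < u" "v < 2 * pi"
  shows "arc_count S u v = card {j. Arg2pi (s j) \<in> {u<..v}}"
  using S1T_esum_arc[OF assms] S1T_finite_arc[OF assms] by (simp add: arc_count_def ecard_def)

lemma S1T_obtain_enumeration:
  assumes "S \<in> S1T"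
  obtains s where "enumeration S s"
  by (rule S_one_enumeration[OF assms[unfolded S1T_def]]) (rule that)

lemma arc_count_add:
  assumes S: "S \<in> S1T" and "0 < u" "u \<le> v" "v \<le> w" "w < 2 * pi"
  shows "arc_count S u w = arc_count S u v + arc_count S v w"
proof -
  obtain s where s: "enumeration S s" using S1T_obtain_enumeration[OF S] .
  have "{j. Arg2pi (s j) \<in> {u<..w}} = {j. Arg2pi (s j) \<in> {u<..v}} \<union> {j. Arg2pi (s j) \<in> {v<..w}}"
    using assms by auto
  moreover have "{j. Arg2pi (s j) \<in> {u<..v}} \<inter> {j. Arg2pi (s j) \<in> {v<..w}} = {}"
    by auto
  ultimately show ?thesis
    using assms S1T_finite_arc[OF S s] by (simp add: arc_count_card[OF S s] card_Un_disjoint)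
qed

text \<open>The angle \<open>pi\<close> is an arbitrary zero level: only differences of levels matter, because
  counting from the base point itself would give infinity.\<close>

definition level :: "complex rigged \<Rightarrow> real \<Rightarrow> int" where
  "level S u = (if pi \<le> u then int (arc_count S pi u) else - int (arc_count S u pi))"

lemma level_diff:
  assumes S: "S \<in> S1T" and uv: "0 < u" "u \<le> v" "v < 2 * pi"
  shows "level S v - level S u = int (arc_count S u v)"
proof -
  consider "pi \<le> u" | "u < pi" "pi \<le> v" | "v < pi" by linarith
  then show ?thesis
  proof cases
    case 1
    then show ?thesis
      using arc_count_add[OF S, of pi u v] uv by (simp add: level_def)
  next
    case 2
    then show ?thesis
      using arc_count_add[OF S, of u pi v] uv by (simp add: level_def)
  next
    case 3
    then show ?thesis
      using arc_count_add[OF S, of u v pi] uv by (simp add: level_def)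
  qed
qed

lemma level_mono: "S \<in> S1T \<Longrightarrow> mono_on {0<..<2 * pi} (level S)"
proof (rule mono_onI)
  fix u v assume "S \<in> S1T" "u \<in> {0<..<2 * pi}" "v \<in> {0<..<2 * pi}" "u \<le> v"
  then have "level S v - level S u = int (arc_count S u v)"
    by (intro level_diff) auto
  then show "level S u \<le> level S v" by simp
qed

section \<open>The \<open>L1\<close> distance of level functions\<close>

text \<open>The interval is open because level functions may be unbounded near both ends, which
  represent the base point.\<close>

definition arc_measure :: "real measure" where
  "arc_measure = restrict_space lborel {0<..<2 * pi}"

definition L1dist :: "(real \<Rightarrow> int) \<Rightarrow> (real \<Rightarrow> int) \<Rightarrow> ennreal" where
  "L1dist f g = (\<integral>\<^sup>+u. ennreal (real_of_int \<bar>f u - g u\<bar>) \<partial>arc_measure)"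

lemma space_arc_measure [simp]: "space arc_measure = {0<..<2 * pi}"
  by (simp add: arc_measure_def space_restrict_space)

lemma emeasure_arc_measure:
  assumes "A \<subseteq> {0<..<2 * pi}"
  shows "emeasure arc_measure A = emeasure lborel A"
  unfolding arc_measure_def by (rule emeasure_restrict_space) (use assms in auto)

lemma sets_arc_measure: "A \<in> sets borel \<Longrightarrow> A \<subseteq> {0<..<2 * pi} \<Longrightarrow> A \<in> sets arc_measure"
  by (auto simp: arc_measure_def sets_restrict_space_iff)

lemma measurable_mono_arc:
  fixes f :: "real \<Rightarrow> int"
  assumes "mono_on {0<..<2 * pi} f"
  shows "(\<lambda>u. real_of_int (f u)) \<in> borel_measurable arc_measure"
proof -
  have "mono_on {0<..<2 * pi} (\<lambda>u. real_of_int (f u))"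
    using assms by (auto simp: mono_on_def)
  then have "(\<lambda>u. real_of_int (f u)) \<in> borel_measurable (restrict_space borel {0<..<2 * pi})"
    by (rule borel_measurable_mono_on_fnc)
  also have "borel_measurable (restrict_space borel {0<..<2 * pi}) = borel_measurable arc_measure"
    by (rule measurable_cong_sets) (simp_all add: arc_measure_def sets_restrict_space)
  finally show ?thesis .
qed

lemma L1dist_commute: "L1dist f g = L1dist g f"
  by (simp add: L1dist_def abs_minus_commute)

lemma L1dist_cong:
  assumes "\<And>u. 0 < u \<Longrightarrow> u < 2 * pi \<Longrightarrow> f u - g u = f' u - g' u"
  shows "L1dist f g = L1dist f' g'"
  unfolding L1dist_def by (rule nn_integral_cong) (use assms in auto)

lemma L1dist_triangle:
  assumes f: "mono_on {0<..<2 * pi} f" and g: "mono_on {0<..<2 * pi} g" and h: "mono_on {0<..<2 * pi} h"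
  shows "L1dist f h \<le> L1dist f g + L1dist g h"
proof -
  note [measurable] = measurable_mono_arc[OF f] measurable_mono_arc[OF g] measurable_mono_arc[OF h]
  have "L1dist f h \<le> (\<integral>\<^sup>+u. ennreal \<bar>real_of_int (f u) - real_of_int (g u)\<bar> +
      ennreal \<bar>real_of_int (g u) - real_of_int (h u)\<bar> \<partial>arc_measure)"
    unfolding L1dist_def
    by (intro nn_integral_mono) (auto simp flip: ennreal_plus intro!: ennreal_leI)
  also have "\<dots> = L1dist f g + L1dist g h"
    by (subst nn_integral_add) (auto simp: L1dist_def)
  finally show ?thesis .
qed

lemma L1dist_shift: "L1dist f (\<lambda>u. f u + k) = ennreal (2 * pi * \<bar>k\<bar>)"
proof -
  have "emeasure arc_measure {0<..<2 * pi} = ennreal (2 * pi)"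
    by (subst emeasure_arc_measure) simp_all
  then show ?thesis
    by (simp add: L1dist_def ennreal_mult' mult.commute)
qed

section \<open>From matchings of rigged sets to nearby level functions\<close>

definition pair_level :: "real \<Rightarrow> real \<Rightarrow> real \<Rightarrow> int" where
  "pair_level a b u = of_bool (a \<le> u) - of_bool (b \<le> u)
     - (if \<bar>a - b\<bar> \<le> pi then 0 else if a < b then 1 else - 1)"

text \<open>The absolute value of \<open>pair_level a b\<close> is the indicator function of the shorter arc joining
  the two angles.\<close>

lemma nn_integral_pair_level:
  assumes ab: "0 \<le> a" "a < 2 * pi" "0 \<le> b" "b < 2 * pi"
  shows "(\<integral>\<^sup>+u. ennreal (real_of_int \<bar>pair_level a b u\<bar>) \<partial>arc_measure) \<le> ennreal (arcdist (cis a) (cis b))"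
proof -
  let ?l = "min a b" and ?r = "max a b"
  \<comment> \<open>If the angles differ by more than \<open>pi\<close>, the shorter arc runs
    through the base point and appears as two end pieces of the interval.\<close>
  define A where "A = {0<..<2 * pi} \<inter> (if \<bar>a - b\<bar> \<le> pi then {?l..<?r} else {0..<?l} \<union> {?r..<2 * pi})"
  have A: "A \<in> sets arc_measure"
    by (rule sets_arc_measure) (auto simp: A_def)
  have "(\<integral>\<^sup>+u. ennreal (real_of_int \<bar>pair_level a b u\<bar>) \<partial>arc_measure) \<le> (\<integral>\<^sup>+u. indicator A u \<partial>arc_measure)"
  proof (rule nn_integral_mono)
    fix u assume "u \<in> space arc_measure"
    then show "ennreal (real_of_int \<bar>pair_level a b u\<bar>) \<le> indicator A u"
      by (auto simp: pair_level_def A_def indicator_def)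
  qed
  also have "\<dots> = emeasure lborel A"
    using A by (simp add: emeasure_arc_measure A_def)
  also have "\<dots> \<le> ennreal (arcdist (cis a) (cis b))"
  proof (cases "\<bar>a - b\<bar> \<le> pi")
    case True
    have "emeasure lborel A \<le> emeasure lborel {?l..<?r}"
      by (rule emeasure_mono) (use True in \<open>auto simp: A_def\<close>)
    also have "\<dots> = ennreal \<bar>a - b\<bar>"
      by (simp add: max_def min_def abs_if)
    finally show ?thesis using True ab by (simp add: arcdist_cis)
  next
    case False
    have "emeasure lborel A \<le> emeasure lborel ({0..<?l} \<union> {?r..<2 * pi})"
      by (rule emeasure_mono) (use False in \<open>auto simp: A_def\<close>)
    also have "\<dots> \<le> emeasure lborel {0..<?l} + emeasure lborel {?r..<2 * pi}"
      by (rule emeasure_subadditive) auto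
    also have "\<dots> = ennreal (?l + (2 * pi - ?r))"
      using ab by (simp add: ennreal_plus)
    also have "?l + (2 * pi - ?r) = 2 * pi - \<bar>a - b\<bar>"
      by (simp add: max_def min_def abs_if)
    finally show ?thesis using False ab by (subst arcdist_cis) auto
  qed
  finally show ?thesis .
qed

text \<open>The sum of \<open>pair_level\<close> over the matched pairs is locally finite and has
  the same increments as \<open>level S - level T\<close>, so the two differ by an integer constant
  \<open>m\<close>. The \<open>L1\<close> norm of the sum is at most the sum of the norms, each
  bounded by an arc length.\<close>

lemma dT_less_imp_level_close:
  assumes S: "S \<in> S1T" and T: "T \<in> S1T" and d: "dT S T < ennreal \<epsilon>"
  shows "\<exists>m. L1dist (level S) (\<lambda>u. level T u + m) < ennreal \<epsilon>"
proof -
  obtain s t where s: "enumeration S s" and t: "enumeration T t"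
    and sum: "(\<Sum>j. ennreal (arcdist (s j) (t j))) < ennreal \<epsilon>"
    using d by (auto simp: dT_def rdist_def INF_less_iff)
  define a b where "a j = Arg2pi (s j)" and "b j = Arg2pi (t j)" for j
  define \<phi> where "\<phi> j u = pair_level (a j) (b j) u" for j u
  \<comment> \<open>These are the pairs with at least one point away from the base point; there are
    finitely many for each \<open>\<eta> > 0\<close>.\<close>
  define F where "F \<eta> = {j. a j \<in> {\<eta><..2 * pi - \<eta>}} \<union> {j. b j \<in> {\<eta><..2 * pi - \<eta>}}" for \<eta>
  have ab: "0 \<le> a j" "a j < 2 * pi" "0 \<le> b j" "b j < 2 * pi" for j
    using Arg2pi by (auto simp: a_def b_def)
  have finF: "finite (F \<eta>)" if "0 < \<eta>" for \<eta>
    using S1T_finite_arc[OF S s, of \<eta> "2 * pi - \<eta>"] S1T_finite_arc[OF T t, of \<eta> "2 * pi - \<eta>"] that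
    by (auto simp: F_def a_def b_def)
  \<comment> \<open>Both angles are close to the ends. At the same end the two step functions agree
    at \<open>u\<close>; at opposite ends the angles differ by more than \<open>pi\<close>, because
    \<open>\<eta> \<le> pi / 2\<close>, and the correction term cancels the remaining step.\<close>
  have supp: "\<phi> j u = 0" if "j \<notin> F \<eta>" "\<eta> < u" "u \<le> 2 * pi - \<eta>" "0 < \<eta>" "\<eta> \<le> pi / 2" for j u \<eta>
  proof -
    have "a j \<le> \<eta> \<or> a j > 2 * pi - \<eta>" "b j \<le> \<eta> \<or> b j > 2 * pi - \<eta>"
      using that(1) by (auto simp: F_def)
    then show ?thesis
      using that ab[of j] by (auto simp: \<phi>_def pair_level_def split: if_splits)
  qed
  define \<Phi> where "\<Phi> u = (\<Sum>j | \<phi> j u \<noteq> 0. \<phi> j u)" for u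
  \<comment> \<open>This margin places \<open>[u, v]\<close> strictly between \<open>\<eta>\<close>
    and \<open>2 * pi - \<eta>\<close>, so that one finite index set serves all points of
    \<open>[u, v]\<close>.\<close>
  define \<eta> where "\<eta> u v = min u (2 * pi - v) / 2" for u v
  have \<eta>: "0 < \<eta> u v" "\<eta> u v \<le> pi / 2" "\<eta> u v < u" "v < 2 * pi - \<eta> u v"
    if "0 < u" "u \<le> v" "v < 2 * pi" for u v
    using that by (auto simp: \<eta>_def min_def field_simps)
  have fin_supp: "{j. \<phi> j w \<noteq> 0} \<subseteq> F (\<eta> u v)" if "0 < u" "u \<le> v" "v < 2 * pi" "u \<le> w" "w \<le> v" for u v w
    using supp[of _ "\<eta> u v" w] \<eta>[of u v] that by force
  have \<Phi>F: "\<Phi> w = (\<Sum>j\<in>F (\<eta> u v). \<phi> j w)" if "0 < u" "u \<le> v" "v < 2 * pi" "u \<le> w" "w \<le> v" for u v w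
    unfolding \<Phi>_def by (rule sum.mono_neutral_left) (use finF \<eta> fin_supp that in auto)
  have card_eq: "(\<Sum>j\<in>F (\<eta> u v). of_bool (c j \<le> v) - of_bool (c j \<le> u)) = int (card {j. c j \<in> {u<..v}})"
    if uv: "0 < u" "u \<le> v" "v < 2 * pi" and c: "{j. c j \<in> {u<..v}} \<subseteq> F (\<eta> u v)" for u v and c :: "nat \<Rightarrow> real"
  proof -
    have "(\<Sum>j\<in>F (\<eta> u v). of_bool (c j \<le> v) - of_bool (c j \<le> u)) =
        (\<Sum>j\<in>F (\<eta> u v). of_bool (c j \<in> {u<..v}) :: int)"
      using uv by (intro sum.cong) auto
    also have "\<dots> = (\<Sum>j | c j \<in> {u<..v}. 1)"
      by (rule sum.mono_neutral_cong_right) (use finF \<eta> uv c in auto)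
    finally show ?thesis by simp
  qed
  have diff: "\<Phi> v - \<Phi> u = (level S v - level T v) - (level S u - level T u)"
    if uv: "0 < u" "u \<le> v" "v < 2 * pi" for u v
  proof -
    \<comment> \<open>The correction term of \<open>pair_level\<close> is constant in the angle and
      drops out of the increment.\<close>
    have "\<Phi> v - \<Phi> u = (\<Sum>j\<in>F (\<eta> u v). (of_bool (a j \<le> v) - of_bool (a j \<le> u))
        - (of_bool (b j \<le> v) - of_bool (b j \<le> u)))"
      unfolding \<Phi>F[OF uv uv(2) order_refl] \<Phi>F[OF uv order_refl uv(2)] sum_subtractf[symmetric]
      by (intro sum.cong) (auto simp: \<phi>_def pair_level_def)
    also have "\<dots> = int (card {j. a j \<in> {u<..v}}) - int (card {j. b j \<in> {u<..v}})"
      unfolding sum_subtractf[of "\<lambda>j. of_bool (a j \<le> v) - of_bool (a j \<le> u)"]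
      using \<eta>[OF uv] by (subst (1 2) card_eq[OF uv]) (auto simp: F_def)
    also have "\<dots> = (level S v - level S u) - (level T v - level T u)"
      using level_diff[OF S uv] level_diff[OF T uv] uv
      by (simp add: arc_count_card[OF S s] arc_count_card[OF T t] a_def b_def)
    finally show ?thesis by simp
  qed
  \<comment> \<open>By \<open>diff\<close>, the function \<open>level S - level T - \<Phi>\<close>
    is constant on the interval; \<open>m\<close> is its value at \<open>pi\<close>.\<close>
  define m where "m = level S pi - level T pi - \<Phi> pi"
  have \<Phi>: "level S u - (level T u + m) = \<Phi> u" if "0 < u" "u < 2 * pi" for u
    using diff[of u pi] diff[of pi u] that by (cases "u \<le> pi") (auto simp: m_def)
  have "L1dist (level S) (\<lambda>u. level T u + m) = (\<integral>\<^sup>+u. ennreal (real_of_int \<bar>\<Phi> u\<bar>) \<partial>arc_measure)"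
    unfolding L1dist_def by (rule nn_integral_cong) (use \<Phi> in auto)
  also have "\<dots> \<le> (\<integral>\<^sup>+u. (\<Sum>j. ennreal (real_of_int \<bar>\<phi> j u\<bar>)) \<partial>arc_measure)"
  proof (rule nn_integral_mono)
    fix u assume "u \<in> space arc_measure"
    then have u: "0 < u" "u \<le> u" "u < 2 * pi" by auto
    have "finite {j. \<phi> j u \<noteq> 0}"
      using fin_supp[OF u] finF[OF \<eta>(1)[OF u]] finite_subset by auto
    moreover have "\<bar>\<Phi> u\<bar> \<le> (\<Sum>j | \<phi> j u \<noteq> 0. \<bar>\<phi> j u\<bar>)"
      unfolding \<Phi>_def by (rule sum_abs)
    then have "ennreal (real_of_int \<bar>\<Phi> u\<bar>) \<le> ennreal (\<Sum>j | \<phi> j u \<noteq> 0. real_of_int \<bar>\<phi> j u\<bar>)"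
      by (intro ennreal_leI) (metis of_int_le_iff of_int_sum)
    ultimately show "ennreal (real_of_int \<bar>\<Phi> u\<bar>) \<le> (\<Sum>j. ennreal (real_of_int \<bar>\<phi> j u\<bar>))"
      by (simp add: order_trans[OF _ sum_le_suminf] flip: sum_ennreal)
  qed
  also have "\<dots> = (\<Sum>j. \<integral>\<^sup>+u. ennreal (real_of_int \<bar>\<phi> j u\<bar>) \<partial>arc_measure)"
  proof (rule nn_integral_suminf)
    fix j
    have "mono_on {0<..<2 * pi} (\<lambda>u. of_bool (a \<le> u) :: int)" for a :: real
      by (auto simp: mono_on_def)
    note [measurable] = measurable_mono_arc[OF this]
    show "(\<lambda>u. ennreal (real_of_int \<bar>\<phi> j u\<bar>)) \<in> borel_measurable arc_measure"
      unfolding \<phi>_def pair_level_def of_int_abs of_int_diff by measurable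
  qed
  also have "\<dots> \<le> (\<Sum>j. ennreal (arcdist (s j) (t j)))"
  proof (rule suminf_le)
    fix j
    show "(\<integral>\<^sup>+u. ennreal (real_of_int \<bar>\<phi> j u\<bar>) \<partial>arc_measure) \<le> ennreal (arcdist (s j) (t j))"
      using nn_integral_pair_level[OF ab, of j j]
      by (simp add: \<phi>_def a_def b_def cis_Arg2pi S1T_enumeration_norm[OF S s] S1T_enumeration_norm[OF T t])
  qed auto
  finally show ?thesis using sum by (auto intro: le_less_trans)
qed

section \<open>Integer shifts and lifting of paths to level functions\<close>

lemma pi_gt_3: "pi > 3"
  by (rule less_le_trans[OF _ pi_approx(1)]) simp

lemma L1dist_shift_triangle:
  assumes "mono_on {0<..<2 * pi} f" "mono_on {0<..<2 * pi} g" "mono_on {0<..<2 * pi} h"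
  shows "L1dist f (\<lambda>u. h u + (k + l)) \<le> L1dist f (\<lambda>u. g u + k) + L1dist g (\<lambda>u. h u + l)"
proof -
  have "L1dist f (\<lambda>u. h u + (k + l)) \<le>
      L1dist f (\<lambda>u. g u + k) + L1dist (\<lambda>u. g u + k) (\<lambda>u. h u + (k + l))"
    by (rule L1dist_triangle) (use assms in \<open>auto simp: mono_on_def\<close>)
  also have "L1dist (\<lambda>u. g u + k) (\<lambda>u. h u + (k + l)) = L1dist g (\<lambda>u. h u + l)"
    by (rule L1dist_cong) simp
  finally show ?thesis .
qed

lemma L1dist_shift_sym: "L1dist f (\<lambda>u. g u + k) = L1dist g (\<lambda>u. f u + (- k))"
  by (subst L1dist_commute, rule L1dist_cong) simp

text \<open>By the triangle inequality \<open>f\<close> lies within 4 of its own shift by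
  \<open>k - l\<close>, whereas a nonzero integer shift costs at least \<open>2 * pi > 6\<close>.
  The tolerance 2 accommodates two errors below 1.\<close>

lemma L1dist_shift_unique:
  assumes f: "mono_on {0<..<2 * pi} f" and g: "mono_on {0<..<2 * pi} g"
    and k: "L1dist f (\<lambda>u. g u + k) \<le> ennreal 2" and l: "L1dist f (\<lambda>u. g u + l) \<le> ennreal 2"
  shows "k = l"
proof (rule ccontr)
  assume "k \<noteq> l"
  have "ennreal (2 * pi * \<bar>k + (- l)\<bar>) = L1dist f (\<lambda>u. f u + (k + (- l)))"
    by (rule L1dist_shift[symmetric])
  also have "\<dots> \<le> L1dist f (\<lambda>u. g u + k) + L1dist g (\<lambda>u. f u + (- l))"
    by (rule L1dist_shift_triangle[OF f g f])
  also have "\<dots> \<le> ennreal 2 + ennreal 2"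
    using k l unfolding L1dist_shift_sym[of f g l] by (rule add_mono)
  also have "\<dots> = ennreal 4" by (simp flip: ennreal_plus)
  finally have "ennreal (2 * pi * \<bar>k + (- l)\<bar>) \<le> ennreal 4" .
  then have "2 * pi * \<bar>k - l\<bar> \<le> 4" by (subst (asm) ennreal_le_iff) auto
  moreover have "2 * pi * \<bar>k - l\<bar> \<ge> 2 * pi * 1"
    using \<open>k \<noteq> l\<close> by (intro mult_left_mono) (auto simp: abs_if)
  ultimately show False using pi_gt_3 by linarith
qed

text \<open>A nonzero integer shift moves a level function by at least \<open>2 * pi\<close>, so the projection of
  level functions modulo the integers is a covering.\<close>

lemma level_path_lifting:
  assumes S: "\<forall>t\<in>{0..1}. S t \<in> S1T" and cont: "path_cont dT S"
  obtains m :: "real \<Rightarrow> int" where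
    "\<And>t \<epsilon>. t \<in> {0..1} \<Longrightarrow> \<epsilon> > 0 \<Longrightarrow> \<exists>\<delta>>0. \<forall>s\<in>{0..1}. \<bar>s - t\<bar> < \<delta> \<longrightarrow>
       L1dist (\<lambda>u. level (S s) u + m s) (\<lambda>u. level (S t) u + m t) < ennreal \<epsilon>"
proof -
  define \<rho> where "\<rho> s t k = L1dist (level (S s)) (\<lambda>u. level (S t) u + k)" for s t k
  have mono: "mono_on {0<..<2 * pi} (level (S t))" if "t \<in> {0..1}" for t
    using S that by (intro level_mono) auto
  have tri: "\<rho> r t (k + l) \<le> \<rho> r s k + \<rho> s t l" if "r \<in> {0..1}" "s \<in> {0..1}" "t \<in> {0..1}" for r s t k l
    unfolding \<rho>_def using mono that by (intro L1dist_shift_triangle) auto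
  have sym: "\<rho> s t k = \<rho> t s (- k)" for s t k
    unfolding \<rho>_def by (rule L1dist_shift_sym)
  have uniq: "k = l" if "s \<in> {0..1}" "t \<in> {0..1}" "\<rho> s t k \<le> ennreal 2" "\<rho> s t l \<le> ennreal 2" for s t k l
    using L1dist_shift_unique[OF mono mono] that unfolding \<rho>_def by blast
  have close: "\<exists>\<delta>>0. \<forall>s\<in>{0..1}. \<bar>s - t\<bar> < \<delta> \<longrightarrow> (\<exists>k. \<rho> s t k < ennreal \<epsilon>)"
    if t: "t \<in> {0..1}" and "\<epsilon> > 0" for t \<epsilon>
  proof -
    obtain \<delta> where \<delta>: "\<delta> > 0" "\<forall>s\<in>{0..1}. \<bar>s - t\<bar> < \<delta> \<longrightarrow> dT (S s) (S t) < ennreal \<epsilon>"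
      using cont t \<open>\<epsilon> > 0\<close> unfolding path_cont_def by meson
    have "\<forall>s\<in>{0..1}. \<bar>s - t\<bar> < \<delta> \<longrightarrow> (\<exists>k. \<rho> s t k < ennreal \<epsilon>)"
      unfolding \<rho>_def using \<delta>(2) S t by (blast intro: dT_less_imp_level_close)
    with \<delta>(1) show ?thesis by blast
  qed
  \<comment> \<open>\<open>\<rho> s t (m t - m s)\<close> is the distance between the shifted level
    functions at \<open>s\<close> and \<open>t\<close>, so this is continuity of the lifted path on
    \<open>I\<close>.\<close>
  define lifts where "lifts I m \<longleftrightarrow> (\<forall>t\<in>I. \<forall>\<epsilon>>0. \<exists>\<delta>>0. \<forall>s\<in>I.
      \<bar>s - t\<bar> < \<delta> \<longrightarrow> \<rho> s t (m t - m s) < ennreal \<epsilon>)" for I and m :: "real \<Rightarrow> int"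
  \<comment> \<open>Bisection: lifts on adjacent intervals can be joined, and lifts exist on short
    intervals around each point.\<close>
  have "0 \<le> (0::real) \<and> 1 \<le> (1::real) \<longrightarrow> (\<exists>m. lifts {0..1} m)"
  proof (rule Bolzano[where P = "\<lambda>a b. 0 \<le> a \<and> b \<le> 1 \<longrightarrow> (\<exists>m. lifts {a..b} m)" and a = 0 and b = 1])
    fix a b c :: real
    assume P: "0 \<le> a \<and> b \<le> 1 \<longrightarrow> (\<exists>m. lifts {a..b} m)" "0 \<le> b \<and> c \<le> 1 \<longrightarrow> (\<exists>m. lifts {b..c} m)"
      and ab: "a \<le> b" and bc: "b \<le> c"
    show "0 \<le> a \<and> c \<le> 1 \<longrightarrow> (\<exists>m. lifts {a..c} m)"
    proof
      assume ac: "0 \<le> a \<and> c \<le> 1"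
      then obtain m1 m2 where m1: "lifts {a..b} m1" and m2: "lifts {b..c} m2"
        using P ab bc by fastforce
      \<comment> \<open>The second lift is moved by a constant integer so that it agrees with the
        first at \<open>b\<close>; a common shift changes no distances.\<close>
      define m where "m t = (if t \<le> b then m1 t else m2 t - m2 b + m1 b)" for t
      have "lifts {a..c} m"
        unfolding lifts_def
      proof (intro ballI allI impI)
        fix t \<epsilon> :: real
        assume t: "t \<in> {a..c}" and \<epsilon>: "\<epsilon> > 0"
        have 1: "\<exists>\<delta>>0. \<forall>s\<in>{a..b}. \<bar>s - t\<bar> < \<delta> \<longrightarrow> \<rho> s t (m t - m s) < ennreal \<epsilon>"
        proof (cases "t \<le> b")
          case True
          then obtain \<delta> where "\<delta> > 0" "\<forall>s\<in>{a..b}. \<bar>s - t\<bar> < \<delta> \<longrightarrow> \<rho> s t (m1 t - m1 s) < ennreal \<epsilon>"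
            using m1 \<epsilon> t unfolding lifts_def by force
          with True show ?thesis by (intro exI[of _ \<delta>]) (auto simp: m_def)
        next
          case False
          \<comment> \<open>No point of \<open>[a, b]\<close> is closer to \<open>t\<close> than
            \<open>t - b\<close>, so the condition is vacuous.\<close>
          then show ?thesis by (intro exI[of _ "t - b"]) auto
        qed
        have 2: "\<exists>\<delta>>0. \<forall>s\<in>{b..c}. \<bar>s - t\<bar> < \<delta> \<longrightarrow> \<rho> s t (m t - m s) < ennreal \<epsilon>"
        proof (cases "t \<ge> b")
          case True
          have m: "m s = m2 s - m2 b + m1 b" if "s \<ge> b" for s
            using that by (auto simp: m_def)
          from True obtain \<delta> where "\<delta> > 0" "\<forall>s\<in>{b..c}. \<bar>s - t\<bar> < \<delta> \<longrightarrow> \<rho> s t (m2 t - m2 s) < ennreal \<epsilon>"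
            using m2 \<epsilon> t unfolding lifts_def by force
          with True show ?thesis by (intro exI[of _ \<delta>]) (auto simp: m)
        next
          case False
          then show ?thesis by (intro exI[of _ "b - t"]) auto
        qed
        obtain \<delta>1 \<delta>2 where "\<delta>1 > 0" "\<delta>2 > 0"
          "\<forall>s\<in>{a..b}. \<bar>s - t\<bar> < \<delta>1 \<longrightarrow> \<rho> s t (m t - m s) < ennreal \<epsilon>"
          "\<forall>s\<in>{b..c}. \<bar>s - t\<bar> < \<delta>2 \<longrightarrow> \<rho> s t (m t - m s) < ennreal \<epsilon>"
          using 1 2 by blast
        moreover have "s \<in> {a..b} \<or> s \<in> {b..c}" if "s \<in> {a..c}" for s
          using that by auto
        ultimately show "\<exists>\<delta>>0. \<forall>s\<in>{a..c}. \<bar>s - t\<bar> < \<delta> \<longrightarrow> \<rho> s t (m t - m s) < ennreal \<epsilon>"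
          by (intro exI[of _ "min \<delta>1 \<delta>2"]) auto
      qed
      then show "\<exists>m. lifts {a..c} m" by blast
    qed
  next
    fix x :: real
    assume "0 \<le> x" "x \<le> 1"
    then have x: "x \<in> {0..1}" by simp
    obtain \<delta> where \<delta>: "\<delta> > 0" "\<forall>s\<in>{0..1}. \<bar>s - x\<bar> < \<delta> \<longrightarrow> (\<exists>k. \<rho> s x k < ennreal 1)"
      using close[OF x, of 1] by auto
    then obtain k where k: "\<And>s. s \<in> {0..1} \<Longrightarrow> \<bar>s - x\<bar> < \<delta> \<Longrightarrow> \<rho> s x (k s) < ennreal 1"
      by metis
    have "\<exists>m. lifts {a..b} m" if ab: "a \<le> x" "x \<le> b" "b - a < \<delta>" "0 \<le> a" "b \<le> 1" for a b
    proof -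
      \<comment> \<open>Subtracting \<open>k s\<close> keeps every level function within 1 of the
        fixed one at \<open>x\<close>.\<close>
      have "lifts {a..b} (\<lambda>s. - k s)"
        unfolding lifts_def
      proof (intro ballI allI impI)
        fix t \<epsilon> :: real
        assume t: "t \<in> {a..b}" and \<epsilon>: "\<epsilon> > 0"
        then have t01: "t \<in> {0..1}" using ab by auto
        obtain \<delta>' where \<delta>': "\<delta>' > 0"
          "\<forall>s\<in>{0..1}. \<bar>s - t\<bar> < \<delta>' \<longrightarrow> (\<exists>l. \<rho> s t l < ennreal (min \<epsilon> 1))"
          using close[OF t01, of "min \<epsilon> 1"] \<epsilon> by auto
        have "\<rho> s t (- k t - - k s) < ennreal \<epsilon>" if s: "s \<in> {a..b}" "\<bar>s - t\<bar> < \<delta>'" for s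
        proof -
          have s01: "s \<in> {0..1}" using s ab by auto
          obtain l where l: "\<rho> s t l < ennreal (min \<epsilon> 1)" using \<delta>'(2) s01 s by blast
          have "\<rho> s t (k s + (- k t)) \<le> \<rho> s x (k s) + \<rho> x t (- k t)"
            by (rule tri[OF s01 x t01])
          also have "\<rho> x t (- k t) = \<rho> t x (k t)" by (simp add: sym[of x t])
          also have "\<rho> s x (k s) + \<rho> t x (k t) \<le> ennreal 1 + ennreal 1"
            using t s ab by (intro add_mono less_imp_le[OF k] s01 t01) auto
          also have "\<dots> = ennreal 2" by (simp flip: ennreal_plus)
          finally have "\<rho> s t (k s + (- k t)) \<le> ennreal 2" .
          moreover have "\<rho> s t l \<le> ennreal 2"
            using l by (rule less_imp_le[OF less_le_trans]) (rule ennreal_leI, simp)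
          \<comment> \<open>Through \<open>x\<close> the shift \<open>k s - k t\<close> is accurate
            to 2, while \<open>l\<close> is accurate to \<open>min \<epsilon> 1\<close>. Uniqueness
            identifies them, which improves the rough bound to \<open>\<epsilon>\<close>.\<close>
          ultimately have "k s + (- k t) = l" using uniq[OF s01 t01] by blast
          with l have "\<rho> s t (- k t - - k s) < ennreal (min \<epsilon> 1)" by (simp add: algebra_simps)
          then show ?thesis by (rule less_le_trans) (simp add: ennreal_leI)
        qed
        with \<delta>'(1) show "\<exists>\<delta>>0. \<forall>s\<in>{a..b}. \<bar>s - t\<bar> < \<delta> \<longrightarrow> \<rho> s t (- k t - - k s) < ennreal \<epsilon>"
          by blast
      qed
      then show ?thesis by blast
    qed
    with \<delta>(1) show "\<exists>d>0. \<forall>a b. a \<le> x \<and> x \<le> b \<and> b - a < d \<longrightarrow> 0 \<le> a \<and> b \<le> 1 \<longrightarrow> (\<exists>m. lifts {a..b} m)"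
      by blast
  qed simp
  then obtain m where m: "lifts {0..1} m" by auto
  have "L1dist (\<lambda>u. level (S s) u + m s) (\<lambda>u. level (S t) u + m t) = \<rho> s t (m t - m s)" for s t
    unfolding \<rho>_def by (rule L1dist_cong) simp
  with m that[of m] show ?thesis unfolding lifts_def by simp
qed

section \<open>Strands as quantiles of level functions\<close>

text \<open>For nondecreasing \<open>f\<close> the sublevel set is an initial segment of the
  interval, and its length is its right end: the quantile of \<open>f\<close> at \<open>i\<close>.
  An empty or full sublevel set gives 0 or \<open>2 * pi\<close>, both of which represent the base
  point.\<close>

definition strand :: "(real \<Rightarrow> int) \<Rightarrow> int \<Rightarrow> real" where
  "strand f i = measure lborel {u \<in> {0<..<2 * pi}. f u \<le> i}"

lemma strand_set_measurable:
  fixes f :: "real \<Rightarrow> int"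
  assumes "mono_on {0<..<2 * pi} f"
  shows "{u \<in> {0<..<2 * pi}. f u \<le> i} \<in> sets arc_measure"
proof -
  note [measurable] = measurable_mono_arc[OF assms]
  have "{u \<in> space arc_measure. real_of_int (f u) \<le> real_of_int i} \<in> sets arc_measure"
    by measurable
  then show ?thesis by simp
qed

lemma sets_arc_measure_lborel: "A \<in> sets arc_measure \<Longrightarrow> A \<in> sets lborel"
  by (auto simp: arc_measure_def sets_restrict_space)

lemma strand_set_fmeasurable:
  fixes f :: "real \<Rightarrow> int"
  assumes "mono_on {0<..<2 * pi} f"
  shows "{u \<in> {0<..<2 * pi}. f u \<le> i} \<in> fmeasurable lborel"
proof (rule fmeasurableI2)
  show "{0<..<2 * pi} \<in> fmeasurable lborel" by (simp add: fmeasurable_def)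
qed (use sets_arc_measure_lborel[OF strand_set_measurable[OF assms]] in auto)

lemma strand_bounds:
  assumes "mono_on {0<..<2 * pi} f"
  shows "0 \<le> strand f i" "strand f i \<le> 2 * pi"
proof -
  have "strand f i \<le> measure lborel {0<..<2 * pi}"
    unfolding strand_def
    by (rule measure_mono_fmeasurable)
      (use sets_arc_measure_lborel[OF strand_set_measurable[OF assms]] in \<open>auto simp: fmeasurable_def\<close>)
  then show "strand f i \<le> 2 * pi" by simp
qed (simp add: strand_def)

lemma suminf_indicator_int_interval:
  fixes p q :: int
  shows "(\<Sum>n. if int_decode n \<in> {p..<q} \<union> {q..<p} then 1 else 0 :: ennreal) = ennreal (real_of_int \<bar>p - q\<bar>)"
proof -
  let ?N = "int_encode ` ({p..<q} \<union> {q..<p})"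
  have "(\<Sum>n. if int_decode n \<in> {p..<q} \<union> {q..<p} then 1 else 0 :: ennreal)
      = (\<Sum>n\<in>?N. if int_decode n \<in> {p..<q} \<union> {q..<p} then 1 else 0)"
  proof (rule suminf_finite)
    fix n assume "n \<notin> ?N"
    then have "int_decode n \<notin> {p..<q} \<union> {q..<p}"
      by (metis image_eqI int_decode_inverse)
    then show "(if int_decode n \<in> {p..<q} \<union> {q..<p} then 1 else 0 :: ennreal) = 0" by simp
  qed simp
  also have "\<dots> = (\<Sum>n\<in>?N. 1)" by (rule sum.cong) auto
  also have "\<dots> = of_nat (card ?N)" by simp
  also have "card ?N = card ({p..<q} \<union> {q..<p})"
    by (rule card_image) (simp add: inj_int_encode inj_on_subset)
  also have "\<dots> = nat \<bar>p - q\<bar>"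
    by (cases "p \<le> q") auto
  finally show ?thesis by (simp add: ennreal_of_nat_eq_real_of_nat)
qed

text \<open>Layer cake: \<open>\<bar>f u - g u\<bar>\<close> counts the integers \<open>i\<close>
  for which \<open>u\<close> lies in exactly one of the two sublevel sets. Integrating gives the sum
  of the measures of their symmetric differences \<open>D i\<close>, and each of these bounds the
  displacement of a strand.\<close>

lemma sum_strand_le_L1dist:
  assumes f: "mono_on {0<..<2 * pi} f" and g: "mono_on {0<..<2 * pi} g"
  shows "(\<Sum>n. ennreal \<bar>strand f (int_decode n) - strand g (int_decode n)\<bar>) \<le> L1dist f g"
proof -
  define A where "A h i = {u \<in> {0<..<2 * pi}. h u \<le> i}" for h :: "real \<Rightarrow> int" and i
  define D where "D i = (A f i - A g i) \<union> (A g i - A f i)" for i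
  note sets = strand_set_measurable[OF f, folded A_def] strand_set_measurable[OF g, folded A_def]
  note fmeas = strand_set_fmeasurable[OF f, folded A_def] strand_set_fmeasurable[OF g, folded A_def]
  have D: "D i \<in> sets arc_measure" for i
    using sets by (auto simp: D_def)
  have Dlb: "D i \<in> fmeasurable lborel" for i
    using fmeas by (auto simp: D_def)
  have "ennreal \<bar>strand f i - strand g i\<bar> \<le> (\<integral>\<^sup>+u. indicator (D i) u \<partial>arc_measure)" for i
  proof -
    have "measure lborel (A f i) \<le> measure lborel (A g i \<union> D i)"
      "measure lborel (A g i) \<le> measure lborel (A f i \<union> D i)"
      using fmeas Dlb[of i] by (auto intro!: measure_mono_fmeasurable simp: D_def)
    moreover have "measure lborel (A g i \<union> D i) \<le> measure lborel (A g i) + measure lborel (D i)"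
      "measure lborel (A f i \<union> D i) \<le> measure lborel (A f i) + measure lborel (D i)"
      using fmeas Dlb[of i] by (auto intro!: measure_Un_le)
    ultimately have "\<bar>strand f i - strand g i\<bar> \<le> measure lborel (D i)"
      by (simp add: strand_def A_def)
    also have "ennreal (measure lborel (D i)) = emeasure lborel (D i)"
      using Dlb by (simp add: emeasure_eq_measure2)
    also have "\<dots> = emeasure arc_measure (D i)"
      by (rule emeasure_arc_measure[symmetric]) (auto simp: D_def A_def)
    finally show ?thesis using D by (simp add: ennreal_leI)
  qed
  then have "(\<Sum>n. ennreal \<bar>strand f (int_decode n) - strand g (int_decode n)\<bar>) \<le>
      (\<Sum>n. \<integral>\<^sup>+u. indicator (D (int_decode n)) u \<partial>arc_measure)"
    by (intro suminf_le) auto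
  also have "\<dots> = (\<integral>\<^sup>+u. (\<Sum>n. indicator (D (int_decode n)) u) \<partial>arc_measure)"
    using D by (intro nn_integral_suminf[symmetric]) auto
  also have "\<dots> = L1dist f g"
    unfolding L1dist_def
  proof (rule nn_integral_cong)
    fix u assume "u \<in> space arc_measure"
    then have "indicator (D i) u = (if i \<in> {f u..<g u} \<union> {g u..<f u} then 1 else 0 :: ennreal)" for i
      by (auto simp: D_def A_def indicator_def)
    then show "(\<Sum>n. indicator (D (int_decode n)) u) = ennreal (real_of_int \<bar>f u - g u\<bar>)"
      by (simp only: suminf_indicator_int_interval)
  qed
  finally show ?thesis .
qed

text \<open>At a jump from \<open>p\<close> to \<open>q\<close> the sublevel set is exactly
  \<open>(0, v)\<close> for \<open>p \<le> i < q\<close>. The plateaus of length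
  \<open>\<eta>\<close> on both sides keep the other strands away from \<open>v\<close>.\<close>

lemma strand_eq_iff:
  assumes f: "mono_on {0<..<2 * pi} f" and \<eta>: "\<eta> > 0" "0 < v - \<eta>" "v + \<eta> < 2 * pi"
    and p: "\<And>u. v - \<eta> \<le> u \<Longrightarrow> u < v \<Longrightarrow> f u = p"
    and q: "\<And>u. v \<le> u \<Longrightarrow> u \<le> v + \<eta> \<Longrightarrow> f u = q"
  shows "strand f i = v \<longleftrightarrow> i \<in> {p..<q}"
proof -
  let ?A = "{u \<in> {0<..<2 * pi}. f u \<le> i}"
  note A = strand_set_fmeasurable[OF f, of i]
  have le: "f u \<le> p" if "0 < u" "u < v" for u
  proof (cases "u \<le> v - \<eta>")
    case True
    then have "f u \<le> f (v - \<eta>)" using that \<eta> by (intro mono_onD[OF f]) auto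
    then show ?thesis using p[of "v - \<eta>"] \<eta> by simp
  qed (use p that in auto)
  have ge: "q \<le> f u" if "v \<le> u" "u < 2 * pi" for u
    using mono_onD[OF f, of v u] that \<eta> q[of v] by simp
  consider "i < p" | "i \<ge> q" | "p \<le> i" "i < q" by linarith
  then show ?thesis
  proof cases
    case 1
    have "?A \<subseteq> {0<..<v - \<eta>}"
    proof safe
      fix u assume u: "u \<in> {0<..<2 * pi}" "f u \<le> i"
      have "u < v - \<eta>"
      proof (rule ccontr)
        assume "\<not> u < v - \<eta>"
        then have "f (v - \<eta>) \<le> f u" using u \<eta> by (intro mono_onD[OF f]) auto
        then show False using p[of "v - \<eta>"] \<eta> u 1 by simp
      qed
      with u show "u \<in> {0<..<v - \<eta>}" by simp
    qed
    then have "strand f i \<le> measure lborel {0<..<v - \<eta>}"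
      unfolding strand_def using A \<eta>
      by (intro measure_mono_fmeasurable) (auto simp: fmeasurable_def)
    then show ?thesis using \<eta> 1 by simp
  next
    case 2
    have "{0<..<v + \<eta>} \<subseteq> ?A"
    proof safe
      fix u assume u: "u \<in> {0<..<v + \<eta>}"
      then have "f u \<le> f (v + \<eta>)" using \<eta> by (intro mono_onD[OF f]) auto
      then show "f u \<le> i" using q[of "v + \<eta>"] \<eta> 2 by simp
    qed (use \<eta> in auto)
    then have "measure lborel {0<..<v + \<eta>} \<le> strand f i"
      unfolding strand_def using A by (intro measure_mono_fmeasurable) auto
    then show ?thesis using \<eta> 2 by simp
  next
    case 3
    have "u \<in> ?A \<longleftrightarrow> u \<in> {0<..<v}" for u
      using le[of u] ge[of u] 3 \<eta> by (cases "u < v") auto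
    then have "?A = {0<..<v}" by blast
    then have "strand f i = v" using \<eta> by (simp add: strand_def)
    with 3 show ?thesis by simp
  qed
qed

text \<open>The level function jumps at the angle of \<open>z\<close> by the multiplicity of
  \<open>z\<close>, and the strands located there are indexed by the integers that the jump
  skips.\<close>

lemma ecard_strand_level:
  assumes S: "S \<in> S1T" and z: "z \<noteq> 1"
  shows "ecard {n. cis (strand (\<lambda>u. level S u + m) (int_decode n)) = z} = S z"
proof -
  let ?f = "\<lambda>u. level S u + m"
  have f: "mono_on {0<..<2 * pi} ?f"
    using level_mono[OF S] by (auto simp: mono_on_def)
  obtain s where s: "enumeration S s" using S1T_obtain_enumeration[OF S] .
  have Sz: "S z = ecard {j. s j = z}" using s by (simp add: enumeration_def)
  show ?thesis
  proof (cases "norm z = 1")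
    case False
    then have "{j. s j = z} = {}" using S1T_enumeration_norm[OF S s] by auto
    moreover have "{n. cis (strand ?f (int_decode n)) = z} = {}" using False by auto
    ultimately show ?thesis by (simp only: Sz)
  next
    case True
    define v where "v = Arg2pi z"
    have zv: "z = cis v" using True by (simp add: v_def cis_Arg2pi)
    then have v: "0 < v" "v < 2 * pi"
      using z Arg2pi[of z] by (auto simp: v_def less_le)
    define a where "a j = Arg2pi (s j)" for j
    have sj: "s j = z \<longleftrightarrow> a j = v" for j
      unfolding a_def v_def by (metis True S1T_enumeration_norm[OF S s] cis_Arg2pi)
    \<comment> \<open>A window around \<open>v\<close> whose ends are halfway to 0 and to
      \<open>2 * pi\<close>; it contains finitely many angles, so \<open>v\<close> is isolated from
      the others.\<close>
    let ?J = "{j. a j \<in> {v / 2<..(v + 2 * pi) / 2}}"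
    have finJ: "finite ?J"
      unfolding a_def using v by (intro S1T_finite_arc[OF S s]) auto
    then obtain d where d: "d > 0" "\<And>x. x \<in> a ` ?J \<Longrightarrow> x \<noteq> v \<Longrightarrow> d \<le> dist v x"
      using finite_set_avoid[of "a ` ?J" v] by (auto simp del: image_Collect)
    define \<eta> where "\<eta> = min (d / 2) (min (v / 4) ((2 * pi - v) / 4))"
    have \<eta>: "\<eta> > 0" "0 < v - \<eta>" "v + \<eta> < 2 * pi" "v / 2 < v - \<eta>" "v + \<eta> \<le> (v + 2 * pi) / 2" "\<eta> < d"
      using d(1) v by (auto simp: \<eta>_def min_def field_simps)
    have near: "a j = v" if "v - \<eta> \<le> a j" "a j \<le> v + \<eta>" for j
    proof (rule ccontr)
      assume "a j \<noteq> v"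
      moreover have "a j \<in> a ` ?J" using that \<eta> by auto
      ultimately have "d \<le> dist v (a j)" by (intro d(2)) auto
      then show False using that \<eta> by (auto simp: dist_real_def)
    qed
    have cnt: "level S w - level S u = int (card {j. a j \<in> {u<..w}})"
      if "v - \<eta> \<le> u" "u \<le> w" "w \<le> v + \<eta>" for u w
      using that \<eta> by (simp add: level_diff[OF S] arc_count_card[OF S s] a_def)
    have p: "?f u = ?f (v - \<eta>)" if "v - \<eta> \<le> u" "u < v" for u
    proof -
      have "a j \<notin> {v - \<eta><..u}" for j using near[of j] that \<eta>(1) by auto
      then have "{j. a j \<in> {v - \<eta><..u}} = {}" by blast
      then have "int (card {j. a j \<in> {v - \<eta><..u}}) = 0" by (simp only: card.empty of_nat_0)
      moreover have "level S u - level S (v - \<eta>) = int (card {j. a j \<in> {v - \<eta><..u}})"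
        by (rule cnt) (use that \<eta>(1) in auto)
      ultimately show ?thesis by linarith
    qed
    have q: "?f u = ?f v" if "v \<le> u" "u \<le> v + \<eta>" for u
    proof -
      have "a j \<notin> {v<..u}" for j using near[of j] that \<eta>(1) by auto
      then have "{j. a j \<in> {v<..u}} = {}" by blast
      then have "int (card {j. a j \<in> {v<..u}}) = 0" by (simp only: card.empty of_nat_0)
      moreover have "level S u - level S v = int (card {j. a j \<in> {v<..u}})"
        by (rule cnt) (use that \<eta>(1) in auto)
      ultimately show ?thesis by linarith
    qed
    have pq: "?f v - ?f (v - \<eta>) = int (card {j. s j = z})"
    proof -
      have "a j \<in> {v - \<eta><..v} \<longleftrightarrow> s j = z" for j using near[of j] \<eta>(1) by (auto simp: sj)
      then have "{j. a j \<in> {v - \<eta><..v}} = {j. s j = z}" by blast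
      moreover have "level S v - level S (v - \<eta>) = int (card {j. a j \<in> {v - \<eta><..v}})"
        by (rule cnt) (use \<eta>(1) in auto)
      ultimately show ?thesis by simp
    qed
    have fin: "finite {j. s j = z}"
      by (rule finite_subset[OF _ finJ]) (use v in \<open>auto simp: sj\<close>)
    have "cis (strand ?f i) = z \<longleftrightarrow> strand ?f i = v" for i
    proof
      assume eq: "cis (strand ?f i) = z"
      \<comment> \<open>Both end values map to the base point, which \<open>z\<close> is not;
        strictly between them \<open>cis\<close> is injective.\<close>
      have "strand ?f i \<noteq> 0" "strand ?f i \<noteq> 2 * pi" using eq z by auto
      then show "strand ?f i = v"
        using strand_bounds[OF f, of i] v eq by (intro cis_eq_imp_eq) (auto simp: zv)
    qed (simp add: zv)
    then have "{n. cis (strand ?f (int_decode n)) = z} = int_encode ` {?f (v - \<eta>)..<?f v}"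
      using strand_eq_iff[OF f \<eta>(1-3) p q] by (force simp: image_iff) 
    then have "ecard {n. cis (strand ?f (int_decode n)) = z} = ecard {?f (v - \<eta>)..<?f v}"
      by (simp only: ecard_image[OF inj_on_subset[OF inj_int_encode subset_UNIV]])
    also have "\<dots> = ecard {j. s j = z}"
      using pq fin by (simp add: ecard_def)
    finally show ?thesis by (simp add: Sz)
  qed
qed

section \<open>Moving the initial lift along the strands\<close>

text \<open>Finiteness chains by the triangle inequality and holds locally, so bisection spreads it
  over the interval. It bounds the total displacement from time 0, while continuity controls nearby
  times only.\<close>

lemma path_ennreal_dist_finite:
  fixes V :: "real \<Rightarrow> real \<Rightarrow> ennreal"
  assumes sym: "\<And>a b. V a b = V b a" and tri: "\<And>a b c. V a c \<le> V a b + V b c"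
    and loc: "\<And>t. t \<in> {0..1} \<Longrightarrow> \<exists>\<delta>>0. \<forall>s\<in>{0..1}. \<bar>s - t\<bar> < \<delta> \<longrightarrow> V s t < \<infinity>"
    and t: "t \<in> {0..1}"
  shows "V 0 t < \<infinity>"
proof -
  have trans: "V a c < \<infinity>" if "V a b < \<infinity>" "V b c < \<infinity>" for a b c
    by (rule le_less_trans[OF tri[of a c b]]) (use that in simp)
  have "0 \<le> (0::real) \<and> t \<le> 1 \<longrightarrow> V 0 t < \<infinity>"
  proof (rule Bolzano[where a = 0 and b = t and P = "\<lambda>a b. 0 \<le> a \<and> b \<le> 1 \<longrightarrow> V a b < \<infinity>"])
    fix a b c :: real
    assume *: "0 \<le> a \<and> b \<le> 1 \<longrightarrow> V a b < \<infinity>" "0 \<le> b \<and> c \<le> 1 \<longrightarrow> V b c < \<infinity>" "a \<le> b" "b \<le> c"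
    show "0 \<le> a \<and> c \<le> 1 \<longrightarrow> V a c < \<infinity>"
    proof
      assume "0 \<le> a \<and> c \<le> 1"
      with *(3,4) have "0 \<le> a \<and> b \<le> 1" "0 \<le> b \<and> c \<le> 1" by auto
      with *(1,2) show "V a c < \<infinity>" by (blast intro: trans)
    qed
  next
    fix r :: real
    assume "0 \<le> r" "r \<le> t"
    with t have "r \<in> {0..1}" by simp
    from loc[OF this] obtain \<delta>
      where \<delta>: "\<delta> > 0" "\<And>s. s \<in> {0..1} \<Longrightarrow> \<bar>s - r\<bar> < \<delta> \<Longrightarrow> V s r < \<infinity>"
      by blast
    have "V a b < \<infinity>" if ab: "a \<le> r" "r \<le> b" "b - a < \<delta>" "0 \<le> a" "b \<le> 1" for a b
    proof (rule trans)
      show "V a r < \<infinity>" by (rule \<delta>(2)) (use ab in auto)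
      show "V r b < \<infinity>" unfolding sym[of r b] by (rule \<delta>(2)) (use ab in auto)
    qed
    with \<delta>(1) show "\<exists>d>0. \<forall>a b. a \<le> r \<and> r \<le> b \<and> b - a < d \<longrightarrow> 0 \<le> a \<and> b \<le> 1 \<longrightarrow> V a b < \<infinity>"
      by blast
  qed (use t in simp)
  with t show ?thesis by simp
qed

lemma lift_strand_path:
  fixes S0 :: "real rigged" and S :: "real \<Rightarrow> complex rigged" and x :: "nat \<Rightarrow> real \<Rightarrow> real"
  assumes S0: "S0 \<in> S1R" and S: "\<forall>t\<in>{0..1}. S t \<in> S1T" and p: "pmap S0 = S 0"
    and strands: "\<And>t z. t \<in> {0..1} \<Longrightarrow> z \<noteq> 1 \<Longrightarrow> ecard {n. cis (x n t) = z} = S t z"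
    and cont: "\<And>t \<epsilon>. t \<in> {0..1} \<Longrightarrow> \<epsilon> > 0 \<Longrightarrow> \<exists>\<delta>>0. \<forall>s\<in>{0..1}. \<bar>s - t\<bar> < \<delta> \<longrightarrow>
      (\<Sum>n. ennreal \<bar>x n s - x n t\<bar>) < ennreal \<epsilon>"
  shows "\<exists>St :: real \<Rightarrow> real rigged.
           (\<forall>t\<in>{0..1}. St t \<in> S1R) \<and> path_cont dR St \<and> St 0 = S0
           \<and> (\<forall>t\<in>{0..1}. S t = pmap (St t))"
proof -
  define V where "V s t = (\<Sum>n. ennreal \<bar>x n s - x n t\<bar>)" for s t
  have finite: "V 0 t < \<infinity>" if "t \<in> {0..1}" for t
  proof (rule path_ennreal_dist_finite[where V = V, OF _ _ _ that])
    show "V a b = V b a" for a b by (simp add: V_def abs_minus_commute)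
  next
    fix a b c
    have "V a c \<le> (\<Sum>n. ennreal \<bar>x n a - x n b\<bar> + ennreal \<bar>x n b - x n c\<bar>)"
      unfolding V_def by (intro suminf_le) (auto simp flip: ennreal_plus intro!: ennreal_leI)
    then show "V a c \<le> V a b + V b c" by (simp add: V_def suminf_add[symmetric])
  next
    fix t :: real assume "t \<in> {0..1}"
    from cont[OF this zero_less_one] obtain \<delta> where "\<delta> > 0"
      and \<delta>: "\<And>s. s \<in> {0..1} \<Longrightarrow> \<bar>s - t\<bar> < \<delta> \<Longrightarrow> V s t < ennreal 1"
      unfolding V_def by blast
    have "V s t < \<infinity>" if "s \<in> {0..1}" "\<bar>s - t\<bar> < \<delta>" for s
      using less_trans[OF \<delta>[OF that] ennreal_less_top] by simp
    with \<open>\<delta> > 0\<close> show "\<exists>\<delta>>0. \<forall>s\<in>{0..1}. \<bar>s - t\<bar> < \<delta> \<longrightarrow> V s t < \<infinity>"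
      by blast
  qed
  obtain e where e: "enumeration S0 e" and e_sum: "(\<Sum>j. ennreal (dist (e j) 0)) < \<infinity>"
    by (rule S_one_enumeration[OF S0[unfolded S1R_def]])
  have S1: "S t 1 = \<infinity>" if "t \<in> {0..1}" for t
    using S that by (auto simp: S1T_def S_one_def S_inf_def)
  \<comment> \<open>The assumption on strands leaves the count over 1 open; infinitely many
    stationary copies of the base point make it \<open>\<infinity>\<close>, as in
    \<open>S t\<close>.\<close>
  define f where "f t a = (case a of Inl n \<Rightarrow> cis (x n t) | Inr (n :: nat) \<Rightarrow> 1)" for t a
  have f_card: "ecard {a. f t a = z} = S t z" if t: "t \<in> {0..1}" for t z
  proof (cases "z = 1")
    case True
    have "infinite (range (Inr :: nat \<Rightarrow> nat + nat))" by (simp add: finite_image_iff)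
    moreover have "range Inr \<subseteq> {a. f t a = z}" using True by (auto simp: f_def)
    ultimately have "infinite {a. f t a = z}" using finite_subset by blast
    then show ?thesis using True t by (simp add: S1 ecard_def)
  next
    case False
    have "a \<in> {a. f t a = z} \<longleftrightarrow> a \<in> Inl ` {n. cis (x n t) = z}" for a
      using False by (cases a) (auto simp: f_def)
    then have "{a. f t a = z} = Inl ` {n. cis (x n t) = z}" by blast
    then show ?thesis using strands[OF t False] by (simp add: ecard_image)
  qed
  have "ecard {a. f 0 a = z} = ecard {j. cis (e j) = z}" for z
  proof -
    have "ecard {j. cis (e j) = z} = pmap S0 z"
      unfolding pmap_def esum_enumeration[OF e] by simp
    then show ?thesis using f_card[of 0 z] p by simp
  qed
  then obtain h where h: "bij h" and cis_h: "\<And>a. cis (e (h a)) = f 0 a"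
    using bij_eq_fibre_ecard[of "f 0" "\<lambda>j. cis (e j)"] by blast
  define y where "y t a = (case a of Inl n \<Rightarrow> x n t | Inr (n :: nat) \<Rightarrow> 0)" for t a
  \<comment> \<open>Each point of the initial lift is translated by the displacement of its partner.
    It differs from \<open>y 0 a\<close> by a multiple of \<open>2 * pi\<close>, and hence keeps
    lying over its partner.\<close>
  define E where "E t a = e (h a) + (y t a - y 0 a)" for t a
  define St where "St t r = ecard {j. E t (inv h j) = r}" for t r
  have enum: "enumeration (St t) (\<lambda>j. E t (inv h j))" for t
    by (simp add: enumeration_def St_def)
  have cis_E: "cis (E t a) = f t a" for t a
  proof -
    have "cis (E t a) = cis (e (h a)) * (cis (y t a) / cis (y 0 a))"
      by (simp add: E_def cis_mult cis_divide)
    then show ?thesis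
      by (auto simp: cis_h f_def y_def split: sum.splits)
  qed
  have E0: "E 0 (inv h j) = e j" for j
    using h by (simp add: E_def bij_is_surj surj_f_inv_f)
  have "St 0 = S0"
    using e by (auto simp: St_def E0 enumeration_def)
  moreover have "S t = pmap (St t)" if t: "t \<in> {0..1}" for t
  proof
    fix z
    have "pmap (St t) z = ecard {j. cis (E t (inv h j)) = z}"
      unfolding pmap_def esum_enumeration[OF enum] by simp
    also have "\<dots> = ecard {j. f t (inv h j) = z}" by (simp add: cis_E)
    also have "\<dots> = ecard {a. f t a = z}"
    proof (rule ecard_bij_betw)
      have "a \<in> inv h ` {j. f t (inv h j) = z}" if "f t a = z" for a
        using that h by (intro image_eqI[of _ _ "h a"]) (simp_all add: bij_is_inj)
      moreover have "inj_on (inv h) {j. f t (inv h j) = z}"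
        using bij_imp_bij_inv[OF h] by (auto simp: bij_def intro: inj_on_subset)
      ultimately show "bij_betw (inv h) {j. f t (inv h j) = z} {a. f t a = z}"
        by (auto simp: bij_betw_def)
    qed
    also have "\<dots> = S t z" by (rule f_card[OF t])
    finally show "S t z = pmap (St t) z" by simp
  qed
  moreover have sum_E: "(\<Sum>j. ennreal (dist (E s (inv h j)) (E t (inv h j)))) = (\<Sum>n. ennreal \<bar>x n s - x n t\<bar>)"
    for s t
  proof -
    \<comment> \<open>Counting measure allows the nonnegative series to be reordered along
      \<open>h\<close>; the stationary summands vanish.\<close>
    let ?F = "\<lambda>a. ennreal \<bar>y s a - y t a\<bar>"
    have "(\<Sum>j. ennreal (dist (E s (inv h j)) (E t (inv h j)))) = (\<Sum>j. ?F (inv h j))"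
      by (simp add: E_def dist_real_def)
    also have "\<dots> = (\<integral>\<^sup>+j. ?F (inv h j) \<partial>count_space UNIV)"
      by (simp add: nn_integral_count_space_nat)
    also have "\<dots> = (\<integral>\<^sup>+a. ?F a \<partial>count_space UNIV)"
      by (rule nn_integral_bij_count_space[OF bij_imp_bij_inv[OF h]])
    also have "\<dots> = (\<integral>\<^sup>+a. ?F a * indicator (range Inl) a \<partial>count_space UNIV)"
    proof (rule nn_integral_cong)
      fix a
      show "?F a = ?F a * indicator (range Inl) a" by (cases a) (auto simp: y_def)
    qed
    also have "\<dots> = (\<integral>\<^sup>+a. ?F a \<partial>count_space (range Inl))"
      by (simp add: nn_integral_count_space_indicator)
    also have "\<dots> = (\<integral>\<^sup>+n. ?F (Inl n) \<partial>count_space UNIV)"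
      by (rule nn_integral_bij_count_space[symmetric]) (simp add: bij_betw_def)
    also have "\<dots> = (\<Sum>n. ennreal \<bar>x n s - x n t\<bar>)"
      by (simp add: nn_integral_count_space_nat y_def)
    finally show ?thesis .
  qed
  moreover have "path_cont dR St"
    unfolding path_cont_def
  proof (intro ballI allI impI)
    fix t \<epsilon> :: real
    assume t: "t \<in> {0..1}" and \<epsilon>: "\<epsilon> > 0"
    have "dR (St s) (St t) \<le> (\<Sum>n. ennreal \<bar>x n s - x n t\<bar>)" for s
    proof -
      have "dR (St s) (St t) \<le> (\<Sum>j. ennreal (dist (E s (inv h j)) (E t (inv h j))))"
        unfolding dR_def rdist_def
        by (rule INF_lower2[of "(\<lambda>j. E s (inv h j), \<lambda>j. E t (inv h j))"]) (simp_all add: enum)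
      then show ?thesis by (simp only: sum_E)
    qed
    with cont[OF t \<epsilon>] show "\<exists>\<delta>>0. \<forall>s\<in>{0..1}. \<bar>s - t\<bar> < \<delta> \<longrightarrow> dR (St s) (St t) < ennreal \<epsilon>"
      by (meson le_less_trans)
  qed
  moreover have "St t \<in> S1R" if t: "t \<in> {0..1}" for t
  proof -
    have E_sum: "(\<Sum>j. ennreal (dist (E t (inv h j)) 0)) < \<infinity>"
    proof -
      have "(\<Sum>j. ennreal (dist (E t (inv h j)) 0)) \<le>
          (\<Sum>j. ennreal (dist (E t (inv h j)) (E 0 (inv h j))) + ennreal (dist (e j) 0))"
        by (intro suminf_le)
          (auto simp: E0 dist_real_def simp flip: ennreal_plus intro!: ennreal_leI)
      also have "\<dots> = (\<Sum>n. ennreal \<bar>x n t - x n 0\<bar>) + (\<Sum>j. ennreal (dist (e j) 0))"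
        by (simp add: suminf_add[symmetric] sum_E)
      also have "\<dots> < \<infinity>"
        using finite[OF t] e_sum by (simp add: V_def abs_minus_commute)
      finally show ?thesis .
    qed
    have "St t 0 = \<infinity>"
    proof -
      \<comment> \<open>Partners of stationary copies are multiples of \<open>2 * pi\<close>. By
        summability all but finitely many are smaller than 1 in absolute value, hence are 0 and
        remain there.\<close>
      have "finite {j. 1 \<le> dist (e j) 0}"
        by (rule finite_large_terms[OF e_sum]) auto
      then have "finite (inv h ` {j. 1 \<le> dist (e j) 0})" by (rule finite_imageI)
      moreover have "infinite (range (Inr :: nat \<Rightarrow> nat + nat))" by (simp add: finite_image_iff)
      ultimately have "infinite (range Inr - inv h ` {j. 1 \<le> dist (e j) 0})"
        using Diff_infinite_finite by blast
      then have "infinite (h ` (range Inr - inv h ` {j. 1 \<le> dist (e j) 0}))"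
        using finite_imageD inj_on_subset[OF bij_is_inj[OF h] subset_UNIV] by blast
      moreover have "h ` (range Inr - inv h ` {j. 1 \<le> dist (e j) 0}) \<subseteq> {j. E t (inv h j) = 0}"
      proof safe
        fix n assume n: "Inr n \<notin> inv h ` {j. 1 \<le> dist (e j) 0}"
        have inv: "inv h (h a) = a" for a using h by (simp add: bij_is_inj)
        have "\<not> 1 \<le> dist (e (h (Inr n))) 0"
        proof
          assume "1 \<le> dist (e (h (Inr n))) 0"
          then have "inv h (h (Inr n)) \<in> inv h ` {j. 1 \<le> dist (e j) 0}" by blast
          with n show False by (simp only: inv)
        qed
        then have "\<bar>e (h (Inr n)) - 0\<bar> < 2 * pi"
          using pi_gt_3 by (simp add: dist_real_def)
        moreover have "cis (e (h (Inr n))) = cis 0"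
          by (simp add: cis_h f_def)
        ultimately have "e (h (Inr n)) = 0" by (intro cis_eq_imp_eq)
        then show "E t (inv h (h (Inr n))) = 0"
          by (simp add: inv E_def y_def)
      qed
      ultimately have "infinite {j. E t (inv h j) = 0}" using finite_subset by blast
      then show ?thesis by (simp add: St_def)
    qed
    then show ?thesis
      unfolding S1R_def by (rule S_one_dist_I[OF enum _ E_sum])
  qed
  ultimately show ?thesis by blast
qed

section \<open>Assembly of the lift from level functions and strands\<close>

theorem mainTheorem5:
  fixes S0 :: "real rigged" and S :: "real \<Rightarrow> complex rigged"
  assumes "S0 \<in> S1R"
    and "\<forall>t\<in>{0..1}. S t \<in> S1T"
    and "path_cont dT S"
    and "pmap S0 = S 0"
  shows "\<exists>St :: real \<Rightarrow> real rigged.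
           (\<forall>t\<in>{0..1}. St t \<in> S1R) \<and> path_cont dR St \<and> St 0 = S0
           \<and> (\<forall>t\<in>{0..1}. S t = pmap (St t))"
proof -
  obtain m :: "real \<Rightarrow> int" where m: "\<And>t \<epsilon>. t \<in> {0..1} \<Longrightarrow> \<epsilon> > 0 \<Longrightarrow> \<exists>\<delta>>0. \<forall>s\<in>{0..1}. \<bar>s - t\<bar> < \<delta> \<longrightarrow>
       L1dist (\<lambda>u. level (S s) u + m s) (\<lambda>u. level (S t) u + m t) < ennreal \<epsilon>"
    using level_path_lifting[OF assms(2,3)] by blast
  define x where "x n t = strand (\<lambda>u. level (S t) u + m t) (int_decode n)" for n t
  have mono: "mono_on {0<..<2 * pi} (\<lambda>u. level (S t) u + m t)" if "t \<in> {0..1}" for t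
    using level_mono[of "S t"] assms(2) that by (auto simp: mono_on_def)
  have le: "(\<Sum>n. ennreal \<bar>x n s - x n t\<bar>) \<le> L1dist (\<lambda>u. level (S s) u + m s) (\<lambda>u. level (S t) u + m t)"
    if "s \<in> {0..1}" "t \<in> {0..1}" for s t
    unfolding x_def by (rule sum_strand_le_L1dist[OF mono mono]) (use that in auto)
  show ?thesis
  proof (rule lift_strand_path[OF assms(1,2,4), of x])
    fix t z assume "t \<in> {0..1::real}" "z \<noteq> (1::complex)"
    then show "ecard {n. cis (x n t) = z} = S t z"
      unfolding x_def using assms(2) by (intro ecard_strand_level) auto
  next
    fix t \<epsilon> :: real assume t: "t \<in> {0..1}" and "\<epsilon> > 0"
    then show "\<exists>\<delta>>0. \<forall>s\<in>{0..1}. \<bar>s - t\<bar> < \<delta> \<longrightarrow> (\<Sum>n. ennreal \<bar>x n s - x n t\<bar>) < ennreal \<epsilon>"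
      using m le by (meson le_less_trans)
  qed
qed

end
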